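(* Let $C$ and $C'$ be two crooked surfaces in $\mathsf{Ein}^3$, given respectively by the configurations $u_+,u_-,v_+,v_-$ and $u'_+,u'_-,v'_+,v'_-$ of vectors in $V$. Then $C$ and $C'$ are disjoint if and only if the four photons $[u_+],[u_-],[v_+],[v_-]$ on the boundary of the stem of $C$ are disjoint from $C'$ and the four photons $[u'_+],[u'_-],[v'_+],[v'_-]$ on the boundary of the stem of $C'$ are disjoint from $C$.
   Context: Let $(V,\omega)$ be a $4$-dimensional real symplectic vector space. The Einstein universe $\mathsf{Ein}^3$ is modelled by the set of Lagrangian $2$-planes of $V$. A point $[p]\in\mathbb P(V)$ represents a photon, namely the set of all Lagrangian $2$-planes containing the line $\mathbb R p$. For pairwise transverse Lagrangian planes $L,P,L'$, let $\pi_L,\pi_{L'}$ be the projections for the splitting $V=L\oplus L'$, and let $q_{L,L'}(v)=\omega(\pi_L(v),\pi_{L'}(v))$. The Maslov index is $m(L,P,L')=\mathrm{sign}(q_{L,L'}|_P)$, the number of positive minus the number of negative eigenvalues. Crooked surface: let $u_+,u_-,v_+,v_-\in V$ be four vectors with $\omega(u_+,v_-)=\omega(u_-,v_+)=1$ and all other $\omega$-products between these four vectors equal to zero. Put $P_0=\mathbb R v_++\mathbb R v_-$, $P_\infty=\mathbb R u_++\mathbb R u_-$. The wings are the unions of the photons in the families $\mathcal W_+=\{[tu_++sv_+] : ts\ge 0\}$ and $\mathcal W_-=\{[tu_-+sv_-] : ts\le 0\}$ (with $(t,s)\neq(0,0)$). With $S_1=\mathbb R u_++\mathbb R v_-$ and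 $S_2=\mathbb R u_-+\mathbb R v_+$, the stem is $$\mathcal S=\{L=\mathbb R w+\mathbb R w' : w\in S_1,\ w'\in S_2 \text{ nonzero},\ L \text{ transverse to } P_0 \text{ and } P_\infty,\ |m(P_0,L,P_\infty)|=2\}.$$ The crooked surface given by $u_+,u_-,v_+,v_-$ is the union in $\mathsf{Ein}^3$ of the two wings and the stem. The four photons on the boundary of the stem are $[u_+],[u_-],[v_+],[v_-]$. *)

theory Defs
  imports "HOL-Analysis.Analysis"
begin

definition symplectic_form :: "('a::real_vector \<Rightarrow> 'a \<Rightarrow> real) \<Rightarrow> bool" where
  "symplectic_form \<omega> \<longleftrightarrow>
     bilinear \<omega> \<and> (\<forall>x. \<omega> x x = 0) \<and> (\<forall>x. (\<forall>y. \<omega> x y = 0) \<longrightarrow> x = 0)"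

text \<open>The Einstein universe as the set of Lagrangian planes; the ambient space is
  meant to have dimension 4.\<close>

definition Ein :: "('a::real_vector \<Rightarrow> 'a \<Rightarrow> real) \<Rightarrow> 'a set set" where
  "Ein \<omega> = {L. subspace L \<and> dim L = 2 \<and> (\<forall>x\<in>L. \<forall>y\<in>L. \<omega> x y = 0)}"

definition photon :: "('a::real_vector \<Rightarrow> 'a \<Rightarrow> real) \<Rightarrow> 'a \<Rightarrow> 'a set set" where
  "photon \<omega> p = {L \<in> Ein \<omega>. span {p} \<subseteq> L}"

definition transverse :: "'a::real_vector set \<Rightarrow> 'a set \<Rightarrow> bool" where
  "transverse L L' \<longleftrightarrow> L \<inter> L' = {0}"

text \<open>\<open>proj_along L L'\<close> is the projection onto \<open>L\<close> with kernel \<open>L'\<close>; it is meaningful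
  only when the whole space is the direct sum of \<open>L\<close> and \<open>L'\<close>.\<close>

definition proj_along :: "'a::real_vector set \<Rightarrow> 'a set \<Rightarrow> 'a \<Rightarrow> 'a" where
  "proj_along L L' v = (THE x. x \<in> L \<and> v - x \<in> L')"

definition polar_form :: "('a::real_vector \<Rightarrow> real) \<Rightarrow> 'a \<Rightarrow> 'a \<Rightarrow> real" where
  "polar_form q x y = (q (x + y) - q x - q y) / 2"

definition gram_matrix :: "('a::real_vector \<Rightarrow> real) \<Rightarrow> ('n::finite \<Rightarrow> 'a) \<Rightarrow> real^'n^'n" where
  "gram_matrix q b = (\<chi> i j. polar_form q (b i) (b j))"

definition eigenspace :: "real^'n^'n \<Rightarrow> real \<Rightarrow> (real^'n) set" where
  "eigenspace A e = {x. A *v x = e *\<^sub>R x}"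

text \<open>Eigenvalues are counted with geometric multiplicity, which for the symmetric
  matrices considered here is also the algebraic one.\<close>

definition matrix_signature :: "real^'n^'n \<Rightarrow> int" where
  "matrix_signature A =
     int (\<Sum>e | e > 0 \<and> eigenspace A e \<noteq> {0}. dim (eigenspace A e)) -
     int (\<Sum>e | e < 0 \<and> eigenspace A e \<noteq> {0}. dim (eigenspace A e))"

text \<open>The signature of a quadratic form on a plane is read off from its Gram matrix in
  some basis of that plane; by Sylvester's law of inertia the choice is irrelevant.\<close>

definition plane_basis :: "'a::real_vector set \<Rightarrow> (2 \<Rightarrow> 'a) \<Rightarrow> bool" where
  "plane_basis P b \<longleftrightarrow> inj b \<and> independent (range b) \<and> span (range b) = P"

definition signature_on :: "'a::real_vector set \<Rightarrow> ('a \<Rightarrow> real) \<Rightarrow> int" where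
  "signature_on P q = matrix_signature (gram_matrix q (SOME b. plane_basis P b))"

definition maslov_index ::
  "('a::real_vector \<Rightarrow> 'a \<Rightarrow> real) \<Rightarrow> 'a set \<Rightarrow> 'a set \<Rightarrow> 'a set \<Rightarrow> int" where
  "maslov_index \<omega> L P L' =
     signature_on P (\<lambda>v. \<omega> (proj_along L L' v) (proj_along L' L v))"

definition crooked_config ::
  "('a::real_vector \<Rightarrow> 'a \<Rightarrow> real) \<Rightarrow> 'a \<Rightarrow> 'a \<Rightarrow> 'a \<Rightarrow> 'a \<Rightarrow> bool" where
  "crooked_config \<omega> up um vp vm \<longleftrightarrow>
     \<omega> up vm = 1 \<and> \<omega> um vp = 1 \<and>
     \<omega> up um = 0 \<and> \<omega> up vp = 0 \<and> \<omega> um vm = 0 \<and> \<omega> vp vm = 0"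

definition wing_plus ::
  "('a::real_vector \<Rightarrow> 'a \<Rightarrow> real) \<Rightarrow> 'a \<Rightarrow> 'a \<Rightarrow> 'a set set" where
  "wing_plus \<omega> up vp =
     \<Union> {photon \<omega> (t *\<^sub>R up + s *\<^sub>R vp) | t s. (t, s) \<noteq> (0, 0) \<and> t * s \<ge> 0}"

definition wing_minus ::
  "('a::real_vector \<Rightarrow> 'a \<Rightarrow> real) \<Rightarrow> 'a \<Rightarrow> 'a \<Rightarrow> 'a set set" where
  "wing_minus \<omega> um vm =
     \<Union> {photon \<omega> (t *\<^sub>R um + s *\<^sub>R vm) | t s. (t, s) \<noteq> (0, 0) \<and> t * s \<le> 0}"

text \<open>The planes \<open>span {w, w'}\<close> below are automatically Lagrangian when
  \<open>crooked_config \<omega> up um vp vm\<close> holds.\<close>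

definition stem ::
  "('a::real_vector \<Rightarrow> 'a \<Rightarrow> real) \<Rightarrow> 'a \<Rightarrow> 'a \<Rightarrow> 'a \<Rightarrow> 'a \<Rightarrow> 'a set set" where
  "stem \<omega> up um vp vm =
     {span {w, w'} | w w'. w \<in> span {up, vm} \<and> w' \<in> span {um, vp} \<and> w \<noteq> 0 \<and> w' \<noteq> 0 \<and>
        transverse (span {w, w'}) (span {vp, vm}) \<and>
        transverse (span {w, w'}) (span {up, um}) \<and>
        \<bar>maslov_index \<omega> (span {vp, vm}) (span {w, w'}) (span {up, um})\<bar> = 2}"

definition crooked_surface ::
  "('a::real_vector \<Rightarrow> 'a \<Rightarrow> real) \<Rightarrow> 'a \<Rightarrow> 'a \<Rightarrow> 'a \<Rightarrow> 'a \<Rightarrow> 'a set set" where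
  "crooked_surface \<omega> up um vp vm =
     wing_plus \<omega> up vp \<union> wing_minus \<omega> um vm \<union> stem \<omega> up um vp vm"

end

theory Submission imports Defs begin

text \<open>A photon \<open>[p]\<close> misses a crooked surface iff \<open>\<omega>(p,u\<^sub>+) \<omega>(p,v\<^sub>+) > 0\<close> and
  \<open>\<omega>(p,u\<^sub>-) \<omega>(p,v\<^sub>-) < 0\<close>. These inequalities pass from the boundary photons of the
  stem to all photons of the wings, so only the two stems could meet. There the inequalities
  prescribe the signs of the matrix of pairings between the two configurations up to four
  signs, and \<open>\<omega>(u'\<^sub>+,u'\<^sub>-) = 0\<close> forces the product of these four to be positive. A common
  plane of the stems gives four vanishing sums of four terms each; since the product of the
  terms of each sum is positive, two of them are positive and two negative, so the signs
  themselves sum to zero. The resulting four linear equations for the four signs have no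
  nonzero solution.\<close>

section \<open>Spans of two vectors and bases of the whole space\<close>

lemma span_pairE:
  assumes "x \<in> span {p, q}"
  obtains a b :: real where "x = a *\<^sub>R p + b *\<^sub>R q"
proof -
  obtain a where "x - a *\<^sub>R p \<in> span {q}"
    using assms by (auto simp: span_breakdown_eq)
  then obtain b where "x - a *\<^sub>R p = b *\<^sub>R q"
    by (auto simp: span_singleton)
  then have "x = a *\<^sub>R p + b *\<^sub>R q"
    by (simp add: algebra_simps)
  then show ?thesis
    by (rule that)
qed

lemma span_pairI: "a *\<^sub>R p + b *\<^sub>R q \<in> span {p, q}"
  by (intro span_add span_scale span_base) auto

lemma independent_pairI:
  assumes "\<And>a b :: real. a *\<^sub>R p + b *\<^sub>R q = 0 \<Longrightarrow> a = 0 \<and> b = 0"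
  shows "p \<noteq> q" "independent {p, q}"
proof -
  show "p \<noteq> q"
    using assms[of 1 "-1"] by auto
  have "q \<noteq> 0"
    using assms[of 0 1] by auto
  have "p \<notin> span {q}"
  proof
    assume "p \<in> span {q}"
    then obtain k where "p = k *\<^sub>R q"
      by (auto simp: span_singleton)
    then show False
      using assms[of 1 "-k"] by simp
  qed
  with \<open>q \<noteq> 0\<close> show "independent {p, q}"
    by (simp add: independent_insert)
qed

text \<open>In a general \<open>real_vector\<close> type \<open>dim\<close> is 0 when there is no
  finite basis, so \<open>card S > 0\<close> is what makes the basis \<open>B\<close> finite. A
  vector outside \<open>span S\<close> would then give an independent set larger than
  \<open>B\<close>.\<close>

lemma span_independent_eq_UNIV:
  fixes S :: "'a::real_vector set"
  assumes "independent S" "card S = dim (UNIV :: 'a set)" "card S > 0"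
  shows "span S = UNIV"
proof -
  obtain B :: "'a set" where B: "UNIV \<subseteq> span B" "card B = dim (UNIV :: 'a set)"
    using real_vector.basis_exists[of UNIV] by metis
  have "finite B"
    using B assms by (simp add: card_ge_0_finite)
  have "x \<in> span S" for x
  proof (rule ccontr)
    assume "x \<notin> span S"
    then have "independent (insert x S)" "x \<notin> S"
      using assms(1) by (auto simp: independent_insert span_base)
    moreover have "insert x S \<subseteq> span B"
      using B(1) by (rule subset_trans[OF subset_UNIV])
    ultimately have "card (insert x S) \<le> card B"
      using real_vector.independent_span_bound[OF \<open>finite B\<close>] by blast
    then show False
      using \<open>x \<notin> S\<close> assms(2,3) B(2) by (simp add: card_ge_0_finite)
  qed
  then show ?thesis
    by blast
qed

section \<open>Signatures of 2 by 2 matrices\<close>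

text \<open>Two distinct eigenvalues satisfying \<open>P\<close> would have the determinant as their
  product, and a two-dimensional eigenspace would make the matrix scalar; either way the determinant
  would be positive. The predicate \<open>P\<close> stands for one of the two signs.\<close>

lemma sum_signature_part_le_1:
  fixes A :: "real^2^2"
  assumes "det A \<le> 0" and P: "\<And>e f. P e \<Longrightarrow> P f \<Longrightarrow> e * f > 0"
  shows "(\<Sum>e | P e \<and> eigenspace A e \<noteq> {0}. dim (eigenspace A e)) \<le> 1"
proof -
  let ?E = "{e. P e \<and> eigenspace A e \<noteq> {0}}"
  have sub: "subspace (eigenspace A e)" for e
    unfolding eigenspace_def subspace_def
    by (simp add: matrix_vector_right_distrib matrix_vector_mult_scaleR algebra_simps)
  have char: "e\<^sup>2 - (A$1$1 + A$2$2) * e + det A = 0" if "e \<in> ?E" for e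
  proof -
    from that obtain x where x: "A *v x = e *\<^sub>R x" "x \<noteq> 0"
      using subspace_0[OF sub, of e] by (auto simp: eigenspace_def)
    have "(A - mat e) *v x = 0"
      using x by (simp add: matrix_vector_mult_diff_rdistrib vec_eq_iff matrix_vector_mult_def
          mat_def sum_2 forall_2 algebra_simps)
    then have "det (A - mat e) = 0"
      using x(2) by (metis invertible_det_nz invertible_left_inverse matrix_left_invertible_ker)
    then show ?thesis
      by (simp add: det_2 mat_def power2_eq_square algebra_simps)
  qed
  have unique: "e = f" if "e \<in> ?E" "f \<in> ?E" for e f
  proof (rule ccontr)
    assume "e \<noteq> f"
    have "(e - f) * (e + f - (A$1$1 + A$2$2)) = 0"
      using char[OF that(1)] char[OF that(2)] by (simp add: power2_eq_square algebra_simps)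
    with \<open>e \<noteq> f\<close> have "A$1$1 + A$2$2 = e + f"
      by simp
    then have "e * f = det A"
      using char[OF that(1)] by (simp add: power2_eq_square algebra_simps)
    moreover have "e * f > 0"
      using that P by blast
    ultimately show False
      using assms(1) by simp
  qed
  have dim: "dim (eigenspace A e) \<le> 1" if "e \<in> ?E" for e
  proof (rule ccontr)
    assume "\<not> ?thesis"
    then have "dim (eigenspace A e) \<ge> DIM(real^2)"
      by simp
    then have "eigenspace A e = UNIV"
      using sub by (metis dim_eq_full dim_subset_UNIV le_antisym span_eq_iff)
    then have "column i A = e *\<^sub>R axis i 1" for i
      by (auto simp: eigenspace_def simp flip: matrix_vector_mult_basis)
    then have "A $ j $ i = (if i = j then e else 0)" for i j
      by (auto simp: column_def vec_eq_iff axis_def)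
    then have "det A = e * e"
      by (simp add: det_2)
    moreover have "e * e > 0"
      using P that by blast
    ultimately show False
      using assms(1) by simp
  qed
  show ?thesis
  proof (cases "?E = {}")
    case False
    then obtain e where e: "e \<in> ?E"
      by blast
    then have "?E = {e}"
      using unique by blast
    then show ?thesis
      using dim[OF e] by simp
  qed (simp only: sum.empty)
qed

text \<open>Used in the contrapositive: a signature of 2 or -2 forces a positive determinant, which
  is how the Maslov condition on the stem becomes an inequality.\<close>

lemma abs_matrix_signature_le_1:
  fixes A :: "real^2^2"
  assumes "det A \<le> 0"
  shows "\<bar>matrix_signature A\<bar> \<le> 1"
proof -
  have "(\<Sum>e | e > 0 \<and> eigenspace A e \<noteq> {0}. dim (eigenspace A e)) \<le> 1"
    "(\<Sum>e | e < 0 \<and> eigenspace A e \<noteq> {0}. dim (eigenspace A e)) \<le> 1"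
    by (rule sum_signature_part_le_1[OF assms]; simp add: mult_neg_neg)+
  then show ?thesis
    unfolding matrix_signature_def by linarith
qed

text \<open>Guarantees that the \<open>SOME\<close> in \<open>signature_on\<close> picks a genuine
  basis.\<close>

lemma plane_basis_exists:
  assumes "independent {p, q}" "p \<noteq> q"
  shows "\<exists>b. plane_basis (span {p, q}) b"
proof -
  define b where "b = (\<lambda>i::2. if i = 1 then p else q)"
  have "range b = {p, q}"
    unfolding UNIV_2 by (auto simp: b_def)
  moreover have "inj b"
    using assms(2) exhaust_2 unfolding inj_def b_def by metis
  ultimately have "plane_basis (span {p, q}) b"
    using assms(1) by (simp add: plane_basis_def)
  then show ?thesis
    by blast
qed

section \<open>Signs of real numbers and of two-term combinations\<close>

lemma signs_cancel:
  fixes w x y z :: real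
  assumes "w + x + y + z = 0" "sgn w * sgn x * sgn y * sgn z = 1"
  shows "sgn w + sgn x + sgn y + sgn z = 0"
  using assms by (auto simp: sgn_if split: if_splits)

lemma sgn_eq_if_mult_pos:
  fixes x y :: real
  assumes "x * y > 0"
  shows "sgn x = sgn y"
  using assms by (auto simp: zero_less_mult_iff)

lemma sgn_eq_if_mult_neg:
  fixes x y :: real
  assumes "x * y < 0"
  shows "sgn x = - sgn y"
  using assms by (auto simp: mult_less_0_iff)

lemma combination_nonzero_mult_pos:
  fixes a b s t :: real
  assumes "a * b > 0" "s * t \<ge> 0" "s * a + t * b = 0"
  shows "s = 0 \<and> t = 0"
proof -
  \<comment> \<open>This is the hypothesis multiplied by \<open>s * b\<close>; both summands turn
    out to be nonnegative.\<close>
  have "s * s * (a * b) + s * t * (b * b) = 0"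
    using assms(3) by (metis (no_types, lifting) distrib_left mult.assoc mult.left_commute mult_zero_right mult.commute)
  moreover have "s * s * (a * b) \<ge> 0" "s * t * (b * b) \<ge> 0"
    using assms by simp_all
  ultimately have "s * s * (a * b) = 0"
    by linarith
  then have "s = 0"
    using assms(1) by auto
  then show ?thesis
    using assms by auto
qed

text \<open>Unless \<open>a = b = 0\<close>, the pair \<open>(b, -a)\<close> works, because its
  product is \<open>-(a * b)\<close>. With \<open>a\<close> and \<open>b\<close> the pairings of
  \<open>p\<close> with the two edges of a wing, this finds a photon of the wing whose vector is
  orthogonal to \<open>p\<close>.\<close>

lemma combination_zero_exists:
  fixes a b :: real
  assumes "a * b \<le> 0"
  shows "\<exists>s t. (s, t) \<noteq> (0, 0) \<and> s * t \<ge> 0 \<and> s * a + t * b = 0"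
proof (cases "a = 0 \<and> b = 0")
  case True
  then show ?thesis
    by (intro exI[of _ 1]) auto
next
  case False
  then show ?thesis
    using assms by (intro exI[of _ b] exI[of _ "-a"]) (auto simp: mult.commute)
qed

section \<open>Alternating forms and incidence of photons\<close>

locale alternating_form =
  fixes \<omega> :: "'a::real_vector \<Rightarrow> 'a \<Rightarrow> real"
  assumes bilinear: "bilinear \<omega>" and alternating: "\<omega> x x = 0"
begin

lemmas form_simps = bilinear_ladd[OF bilinear] bilinear_radd[OF bilinear]
  bilinear_lmul[OF bilinear] bilinear_rmul[OF bilinear] bilinear_lneg[OF bilinear]
  bilinear_rneg[OF bilinear] bilinear_lsub[OF bilinear] bilinear_rsub[OF bilinear]
  bilinear_lzero[OF bilinear] bilinear_rzero[OF bilinear] alternating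

lemma skew: "\<omega> y x = - \<omega> x y"
  using alternating[of "x + y"] alternating[of x] alternating[of y]
  unfolding bilinear_ladd[OF bilinear] bilinear_radd[OF bilinear] by linarith

lemma isotropic_span_pair:
  assumes "\<omega> p q = 0" "x \<in> span {p, q}" "y \<in> span {p, q}"
  shows "\<omega> x y = 0"
  using assms(2,3) by (auto elim!: span_pairE simp: form_simps assms(1) skew[of q p])

lemma orthogonal_span:
  assumes "\<And>x. x \<in> S \<Longrightarrow> \<omega> x z = 0" "x \<in> span S"
  shows "\<omega> x z = 0"
  using assms(2) by (induction rule: span_induct) (auto simp: subspace_def form_simps assms(1))

lemma not_in_spanI:
  assumes "\<omega> x z \<noteq> 0" "\<And>y. y \<in> S \<Longrightarrow> \<omega> y z = 0"
  shows "x \<notin> span S"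
  using assms orthogonal_span by blast

lemma span_pair_in_Ein:
  assumes "\<omega> p q = 0" "p \<noteq> q" "independent {p, q}"
  shows "span {p, q} \<in> Ein \<omega>"
  unfolding Ein_def using assms isotropic_span_pair by (auto simp: dim_eq_card_independent)

text \<open>Orthogonal independent \<open>p\<close> and \<open>q\<close> span a common Lagrangian
  plane. If \<open>p\<close> is a multiple of \<open>q\<close>, that span is too small, and
  \<open>z\<close> serves to complete \<open>q\<close> to a plane.\<close>

lemma photons_meet:
  assumes "\<omega> p q = 0" "\<omega> q z = 0" "q \<noteq> z" "independent {q, z}"
  shows "photon \<omega> p \<inter> photon \<omega> q \<noteq> {}"
proof (cases "p \<in> span {q}")
  case True
  have "span {q} \<subseteq> span {q, z}"
    by (intro span_mono) auto
  moreover from this True have "span {p} \<subseteq> span {q, z}"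
    by (metis insert_subset empty_subsetI span_minimal subsetD subspace_span)
  ultimately show ?thesis
    using span_pair_in_Ein[OF assms(2-4)] unfolding photon_def by blast
next
  case False
  have "q \<noteq> 0"
    using assms(4) dependent_zero by blast
  then have "independent {p, q}" "p \<noteq> q"
    using False by (auto simp: independent_insert span_base)
  then have "span {p, q} \<in> Ein \<omega>"
    using span_pair_in_Ein[OF assms(1)] by blast
  moreover have "span {p} \<subseteq> span {p, q}" "span {q} \<subseteq> span {p, q}"
    by (intro span_mono; auto)+
  ultimately show ?thesis
    unfolding photon_def by blast
qed

lemma photons_of_Lagrangian_pencil_meet:
  assumes "\<omega> x y = 0" "\<And>a b. a *\<^sub>R x + b *\<^sub>R y = 0 \<Longrightarrow> a = 0 \<and> b = 0"
    and "(s, t) \<noteq> (0, 0)" "\<omega> p (s *\<^sub>R x + t *\<^sub>R y) = 0"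
  shows "photon \<omega> p \<inter> photon \<omega> (s *\<^sub>R x + t *\<^sub>R y) \<noteq> {}"
\<comment> \<open>The auxiliary vector has the coefficients \<open>(s, t)\<close> rotated by a right
  angle: it stays in the isotropic span of \<open>x\<close> and \<open>y\<close>, and the
  determinant of the two coefficient pairs is \<open>s * s + t * t\<close>, which is
  nonzero.\<close>
proof (rule photons_meet[OF assms(4), of "(- t) *\<^sub>R x + s *\<^sub>R y"])
  have "\<omega> y x = 0"
    using assms(1) skew[of x y] by simp
  with assms(1) show "\<omega> (s *\<^sub>R x + t *\<^sub>R y) ((- t) *\<^sub>R x + s *\<^sub>R y) = 0"
    by (simp only: form_simps) simp
  have *: "a = 0 \<and> b = 0"
    if "a *\<^sub>R (s *\<^sub>R x + t *\<^sub>R y) + b *\<^sub>R ((- t) *\<^sub>R x + s *\<^sub>R y) = 0" for a b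
  proof -
    have "(a * s - b * t) *\<^sub>R x + (a * t + b * s) *\<^sub>R y = 0"
      using that by (simp add: algebra_simps)
    then have eq: "a * s - b * t = 0" "a * t + b * s = 0"
      using assms(2) by blast+
    have "a * (s * s + t * t) = 0" "b * (s * s + t * t) = 0"
      using eq by algebra+
    moreover have "s * s + t * t \<noteq> 0"
      using assms(3) by simp
    ultimately show ?thesis
      by (metis mult_eq_0_iff)
  qed
  show "s *\<^sub>R x + t *\<^sub>R y \<noteq> (- t) *\<^sub>R x + s *\<^sub>R y"
    "independent {s *\<^sub>R x + t *\<^sub>R y, (- t) *\<^sub>R x + s *\<^sub>R y}"
    using independent_pairI[OF *] by blast+
qed

lemma photon_memD:
  assumes "L \<in> photon \<omega> p"
  shows "p \<in> L" "\<And>x y. x \<in> L \<Longrightarrow> y \<in> L \<Longrightarrow> \<omega> x y = 0"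
  using assms span_base[of p "{p}"] by (auto simp: photon_def Ein_def)

end

section \<open>A single crooked surface: its symplectic basis and its wings\<close>

locale crooked = alternating_form +
  fixes up um vp vm
  assumes config: "crooked_config \<omega> up um vp vm"
begin

lemma pairings [simp]:
  "\<omega> up vm = 1" "\<omega> um vp = 1" "\<omega> up um = 0" "\<omega> up vp = 0" "\<omega> um vm = 0" "\<omega> vp vm = 0"
  "\<omega> vm up = -1" "\<omega> vp um = -1" "\<omega> um up = 0" "\<omega> vp up = 0" "\<omega> vm um = 0" "\<omega> vm vp = 0"
  using config skew[of vm up] skew[of vp um] skew[of um up] skew[of vp up] skew[of vm um]
    skew[of vm vp] unfolding crooked_config_def by simp_all

lemma combination_eq_0:
  assumes "a *\<^sub>R up + b *\<^sub>R um + c *\<^sub>R vp + d *\<^sub>R vm = 0"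
  shows "a = 0 \<and> b = 0 \<and> c = 0 \<and> d = 0"
proof -
  have "\<omega> (a *\<^sub>R up + b *\<^sub>R um + c *\<^sub>R vp + d *\<^sub>R vm) z = 0" for z
    using assms by (simp add: form_simps)
  from this[of up] this[of um] this[of vp] this[of vm] show ?thesis
    by (simp add: form_simps)
qed

text \<open>In dimension 4 the configuration is a symplectic basis, so the coordinates of
  \<open>x\<close> are, up to sign, its pairings with the four vectors. Here the dimension
  enters.\<close>

lemma form_expansion:
  assumes "dim (UNIV :: 'a set) = 4"
  shows "\<omega> x y = \<omega> up x * \<omega> vm y - \<omega> vm x * \<omega> up y + \<omega> um x * \<omega> vp y - \<omega> vp x * \<omega> um y"
proof -
  have ne: "up \<noteq> um" "up \<noteq> vp" "up \<noteq> vm" "um \<noteq> vp" "um \<noteq> vm" "vp \<noteq> vm"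
    using pairings by (metis zero_neq_one alternating)+
  \<comment> \<open>Each vector pairs nontrivially with its partner, while the vectors after it in
    the list do not.\<close>
  have "up \<notin> span {um, vp, vm}"
    by (rule not_in_spanI[of _ vm]) (auto simp: alternating)
  moreover have "um \<notin> span {vp, vm}"
    by (rule not_in_spanI[of _ vp]) (auto simp: alternating)
  moreover have "vp \<notin> span {vm}"
    by (rule not_in_spanI[of _ um]) auto
  moreover have "vm \<noteq> 0"
    using pairings(1) by (auto simp: form_simps simp del: pairings)
  ultimately have "independent {up, um, vp, vm}"
    using ne by (simp add: independent_insert)
  then have "span {up, um, vp, vm} = UNIV"
    using ne assms by (intro span_independent_eq_UNIV) simp_all
  then have "x \<in> span {up, um, vp, vm}"
    by simp
  then obtain a b c d where "x - a *\<^sub>R up - b *\<^sub>R um - c *\<^sub>R vp = d *\<^sub>R vm"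
    by (auto simp: span_breakdown_eq span_singleton)
  then have "x = a *\<^sub>R up + b *\<^sub>R um + c *\<^sub>R vp + d *\<^sub>R vm"
    by (simp add: algebra_simps)
  then show ?thesis
    by (simp add: form_simps)
qed

lemma wing_plus_photon_subset:
  assumes "(t, s) \<noteq> (0, 0)" "t * s \<ge> 0"
  shows "photon \<omega> (t *\<^sub>R up + s *\<^sub>R vp) \<subseteq> crooked_surface \<omega> up um vp vm"
  using assms unfolding crooked_surface_def wing_plus_def by blast

lemma wing_minus_photon_subset:
  assumes "(t, s) \<noteq> (0, 0)" "t * s \<le> 0"
  shows "photon \<omega> (t *\<^sub>R um + s *\<^sub>R vm) \<subseteq> crooked_surface \<omega> up um vp vm"
  using assms unfolding crooked_surface_def wing_minus_def by blast

text \<open>If an inequality fails, \<open>p\<close> is orthogonal to the vector of some photon of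
  the corresponding wing, and photons of orthogonal vectors meet.\<close>

lemma photon_disjointD:
  assumes "photon \<omega> p \<inter> crooked_surface \<omega> up um vp vm = {}"
  shows "\<omega> p up * \<omega> p vp > 0" "\<omega> p um * \<omega> p vm < 0"
proof -
  show "\<omega> p up * \<omega> p vp > 0"
  proof (rule ccontr)
    assume "\<not> ?thesis"
    then obtain s t where st: "(s, t) \<noteq> (0, 0)" "s * t \<ge> 0" "s * \<omega> p up + t * \<omega> p vp = 0"
      using combination_zero_exists[of "\<omega> p up" "\<omega> p vp"] by auto
    have "photon \<omega> p \<inter> photon \<omega> (s *\<^sub>R up + t *\<^sub>R vp) \<noteq> {}"
      by (rule photons_of_Lagrangian_pencil_meet)
        (use st combination_eq_0[of _ 0 _ 0] in \<open>auto simp: form_simps\<close>)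
    then show False
      using assms wing_plus_photon_subset[OF st(1,2)] by blast
  qed
  show "\<omega> p um * \<omega> p vm < 0"
  proof (rule ccontr)
    assume "\<not> ?thesis"
    \<comment> \<open>Replacing \<open>vm\<close> by its negative turns the sign condition of the
      minus wing into that of the plus wing.\<close>
    then obtain s t where st: "(s, t) \<noteq> (0, 0)" "s * t \<ge> 0" "s * \<omega> p um + t * - \<omega> p vm = 0"
      using combination_zero_exists[of "\<omega> p um" "- \<omega> p vm"] by auto
    have "photon \<omega> p \<inter> photon \<omega> (s *\<^sub>R um + (- t) *\<^sub>R vm) \<noteq> {}"
      by (rule photons_of_Lagrangian_pencil_meet)
        (use st combination_eq_0[of 0 _ 0 _] in \<open>auto simp: form_simps\<close>)
    moreover have "(s, - t) \<noteq> (0, 0)" "s * - t \<le> 0"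
      using st by auto
    note wing_minus_photon_subset[OF this]
    ultimately show False
      using assms by blast
  qed
qed

text \<open>These photons are the edges of the wings, where one parameter vanishes and so
  \<open>t * s = 0\<close>. This yields the easy implication of the theorem.\<close>

lemma boundary_photon_subset:
  assumes "p \<in> {up, um, vp, vm}"
  shows "photon \<omega> p \<subseteq> crooked_surface \<omega> up um vp vm"
  using assms wing_plus_photon_subset[of 1 0] wing_plus_photon_subset[of 0 1]
    wing_minus_photon_subset[of 1 0] wing_minus_photon_subset[of 0 1] by auto

section \<open>Projections, the Maslov index and the stem\<close>

lemma proj_along_P0:
  "proj_along (span {vp, vm}) (span {up, um}) (a *\<^sub>R up + b *\<^sub>R um + c *\<^sub>R vp + d *\<^sub>R vm)
    = c *\<^sub>R vp + d *\<^sub>R vm" (is "proj_along ?P ?Q ?v = _")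
  unfolding proj_along_def
proof (rule the_equality)
  show "c *\<^sub>R vp + d *\<^sub>R vm \<in> ?P \<and> ?v - (c *\<^sub>R vp + d *\<^sub>R vm) \<in> ?Q"
    by (simp add: span_pairI)
next
  fix x
  assume x: "x \<in> ?P \<and> ?v - x \<in> ?Q"
  then obtain c' d' where x': "x = c' *\<^sub>R vp + d' *\<^sub>R vm"
    by (auto elim: span_pairE)
  from x obtain a' b' where "?v - x = a' *\<^sub>R up + b' *\<^sub>R um"
    by (auto elim: span_pairE)
  then have "(a - a') *\<^sub>R up + (b - b') *\<^sub>R um + (c - c') *\<^sub>R vp + (d - d') *\<^sub>R vm = 0"
    by (simp add: x' algebra_simps)
  then show "x = c *\<^sub>R vp + d *\<^sub>R vm"
    using combination_eq_0 x' by fastforce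
qed

lemma proj_along_P_infinity:
  "proj_along (span {up, um}) (span {vp, vm}) (a *\<^sub>R up + b *\<^sub>R um + c *\<^sub>R vp + d *\<^sub>R vm)
    = a *\<^sub>R up + b *\<^sub>R um" (is "proj_along ?P ?Q ?v = _")
  unfolding proj_along_def
proof (rule the_equality)
  show "a *\<^sub>R up + b *\<^sub>R um \<in> ?P \<and> ?v - (a *\<^sub>R up + b *\<^sub>R um) \<in> ?Q"
    using span_pairI[of c vp d vm] span_pairI[of a up b um] by (simp add: algebra_simps)
next
  fix x
  assume x: "x \<in> ?P \<and> ?v - x \<in> ?Q"
  then obtain a' b' where x': "x = a' *\<^sub>R up + b' *\<^sub>R um"
    by (auto elim: span_pairE)
  from x obtain c' d' where "?v - x = c' *\<^sub>R vp + d' *\<^sub>R vm"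
    by (auto elim: span_pairE)
  then have "(a - a') *\<^sub>R up + (b - b') *\<^sub>R um + (c - c') *\<^sub>R vp + (d - d') *\<^sub>R vm = 0"
    by (simp add: x' algebra_simps)
  then show "x = a *\<^sub>R up + b *\<^sub>R um"
    using combination_eq_0 x' by fastforce
qed

text \<open>In the basis of the two given vectors the form is diagonal with entries
  \<open>-(a * b)\<close> and \<open>-(c * d)\<close>. The index is computed in an arbitrary basis,
  but a change of basis multiplies the determinant by a square, and an index of 2 or -2 excludes a
  nonpositive determinant.\<close>

lemma maslov_index_definite:
  assumes nz: "a *\<^sub>R up + b *\<^sub>R vm \<noteq> 0" "c *\<^sub>R um + d *\<^sub>R vp \<noteq> 0"
    and maslov: "\<bar>maslov_index \<omega> (span {vp, vm}) (span {a *\<^sub>R up + b *\<^sub>R vm, c *\<^sub>R um + d *\<^sub>R vp})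
      (span {up, um})\<bar> = 2"
  shows "(a * b) * (c * d) > 0"
proof -
  let ?w = "a *\<^sub>R up + b *\<^sub>R vm" and ?w' = "c *\<^sub>R um + d *\<^sub>R vp"
  define q where "q = (\<lambda>v. \<omega> (proj_along (span {vp, vm}) (span {up, um}) v)
    (proj_along (span {up, um}) (span {vp, vm}) v))"
  define e where "e = (SOME e. plane_basis (span {?w, ?w'}) e)"
  have q: "q (x *\<^sub>R ?w + y *\<^sub>R ?w') = - (x * x * (a * b) + y * y * (c * d))" for x y
  proof -
    have "x *\<^sub>R ?w + y *\<^sub>R ?w'
        = (x * a) *\<^sub>R up + (y * c) *\<^sub>R um + (y * d) *\<^sub>R vp + (x * b) *\<^sub>R vm"
      by (simp add: algebra_simps)
    then have "q (x *\<^sub>R ?w + y *\<^sub>R ?w')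
        = \<omega> ((y * d) *\<^sub>R vp + (x * b) *\<^sub>R vm) ((x * a) *\<^sub>R up + (y * c) *\<^sub>R um)"
      unfolding q_def by (simp only: proj_along_P0 proj_along_P_infinity)
    also have "\<dots> = - (x * x * (a * b) + y * y * (c * d))"
      by (simp add: form_simps algebra_simps)
    finally show ?thesis .
  qed
  have polar: "polar_form q (x *\<^sub>R ?w + y *\<^sub>R ?w') (x' *\<^sub>R ?w + y' *\<^sub>R ?w')
      = - (x * x' * (a * b) + y * y' * (c * d))" for x y x' y'
  proof -
    have "(x *\<^sub>R ?w + y *\<^sub>R ?w') + (x' *\<^sub>R ?w + y' *\<^sub>R ?w')
        = (x + x') *\<^sub>R ?w + (y + y') *\<^sub>R ?w'"
      by (simp add: algebra_simps)
    then show ?thesis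
      unfolding polar_form_def q by (simp only: q) (simp add: field_simps)
  qed
  have "x = 0 \<and> y = 0" if "x *\<^sub>R ?w + y *\<^sub>R ?w' = 0" for x y
  proof -
    have "(x * a) *\<^sub>R up + (y * c) *\<^sub>R um + (y * d) *\<^sub>R vp + (x * b) *\<^sub>R vm = 0"
      using that by (simp add: algebra_simps)
    then show ?thesis
      using combination_eq_0 nz by fastforce
  qed
  then have "\<exists>e. plane_basis (span {?w, ?w'}) e"
    using plane_basis_exists independent_pairI[of ?w ?w'] by blast
  then have "plane_basis (span {?w, ?w'}) e"
    unfolding e_def by (rule someI_ex)
  then have "e i \<in> span {?w, ?w'}" for i
    unfolding plane_basis_def by (metis rangeI span_base)
  then have "\<exists>x y. e i = x *\<^sub>R ?w + y *\<^sub>R ?w'" for i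
    by (metis span_pairE)
  then obtain x y where e: "\<And>i. e i = x i *\<^sub>R ?w + y i *\<^sub>R ?w'"
    by metis
  have "gram_matrix q e $ i $ j = - (x i * x j * (a * b) + y i * y j * (c * d))" for i j
    unfolding gram_matrix_def by (simp only: e polar vec_lambda_beta)
  \<comment> \<open>The squared factor is the determinant of the base change from \<open>?w\<close>,
    \<open>?w'\<close> to \<open>e\<close>.\<close>
  then have "det (gram_matrix q e) = (a * b) * (c * d) * (x 1 * y 2 - x 2 * y 1)\<^sup>2"
    by (simp only: det_2) (simp add: power2_eq_square algebra_simps)
  moreover have "\<not> det (gram_matrix q e) \<le> 0"
    using maslov abs_matrix_signature_le_1[of "gram_matrix q e"]
    unfolding maslov_index_def signature_on_def q_def e_def by linarith
  ultimately show ?thesis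
    by (smt (verit) mult_nonpos_nonneg zero_le_power2)
qed

text \<open>Normal form of a stem plane: both generators are rescaled to have coefficient 1 at
  \<open>up\<close> and \<open>um\<close>, and the Maslov condition says that the slopes
  \<open>m\<close> and \<open>n\<close> have the same sign.\<close>

lemma stemE:
  assumes "L \<in> stem \<omega> up um vp vm"
  obtains m n where "up + m *\<^sub>R vm \<in> L" "um + n *\<^sub>R vp \<in> L" "m * n > 0"
    "\<And>x y. x \<in> L \<Longrightarrow> y \<in> L \<Longrightarrow> \<omega> x y = 0"
proof -
  obtain w w' where L: "L = span {w, w'}" "w \<in> span {up, vm}" "w' \<in> span {um, vp}"
    "w \<noteq> 0" "w' \<noteq> 0" "\<bar>maslov_index \<omega> (span {vp, vm}) L (span {up, um})\<bar> = 2"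
    using assms unfolding stem_def by blast
  from L(2) obtain a b where w: "w = a *\<^sub>R up + b *\<^sub>R vm"
    by (rule span_pairE)
  from L(3) obtain c d where w': "w' = c *\<^sub>R um + d *\<^sub>R vp"
    by (rule span_pairE)
  have pos: "(a * b) * (c * d) > 0"
    using maslov_index_definite L w w' by blast
  then have nz: "a \<noteq> 0" "c \<noteq> 0"
    by auto
  have "inverse a *\<^sub>R w \<in> L" "inverse c *\<^sub>R w' \<in> L"
    unfolding L by (intro span_scale span_base; simp)+
  then have "up + (b / a) *\<^sub>R vm \<in> L" "um + (d / c) *\<^sub>R vp \<in> L"
    using nz by (simp_all add: w w' scaleR_add_right divide_inverse mult.commute)
  moreover have "(b / a) * (d / c) = (a * b) * (c * d) / (a * c)\<^sup>2"
    using nz by (simp add: field_simps power2_eq_square)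
  then have "(b / a) * (d / c) > 0"
    using pos nz by simp
  moreover have "\<omega> w w' = 0"
    by (simp add: w w' form_simps)
  then have "\<omega> x y = 0" if "x \<in> L" "y \<in> L" for x y
    using isotropic_span_pair that unfolding L by blast
  ultimately show ?thesis
    using that by blast
qed

lemma crooked_surface_isotropic:
  assumes "L \<in> crooked_surface \<omega> up um vp vm" "x \<in> L" "y \<in> L"
  shows "\<omega> x y = 0"
  using assms unfolding crooked_surface_def wing_plus_def wing_minus_def
  by (auto elim: stemE dest: photon_memD(2))

text \<open>On a wing the inequalities keep the pairing with \<open>p\<close> from vanishing. On the
  stem, orthogonality of \<open>p\<close> to the two normalised generators makes the product of the
  two hypothesis terms equal to \<open>m * n\<close> times a square, although the hypotheses make it
  negative.\<close>

lemma photon_disjointI: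
  assumes "\<omega> p up * \<omega> p vp > 0" "\<omega> p um * \<omega> p vm < 0"
  shows "photon \<omega> p \<inter> crooked_surface \<omega> up um vp vm = {}"
proof (rule ccontr)
  assume "\<not> ?thesis"
  then obtain L where L: "L \<in> photon \<omega> p" "L \<in> crooked_surface \<omega> up um vp vm"
    by blast
  note p = photon_memD[OF L(1)]
  from L(2) consider "L \<in> wing_plus \<omega> up vp" | "L \<in> wing_minus \<omega> um vm"
    | "L \<in> stem \<omega> up um vp vm"
    unfolding crooked_surface_def by blast
  then show False
  proof cases
    case 1
    then obtain t s where ts: "(t, s) \<noteq> (0, 0)" "t * s \<ge> 0" "L \<in> photon \<omega> (t *\<^sub>R up + s *\<^sub>R vp)"
      unfolding wing_plus_def by blast
    have "t * \<omega> p up + s * \<omega> p vp = 0"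
      using p(2)[OF p(1) photon_memD(1)[OF ts(3)]] by (simp add: form_simps)
    then show False
      using combination_nonzero_mult_pos[OF assms(1) ts(2)] ts(1) by simp
  next
    case 2
    then obtain t s where ts: "(t, s) \<noteq> (0, 0)" "t * s \<le> 0" "L \<in> photon \<omega> (t *\<^sub>R um + s *\<^sub>R vm)"
      unfolding wing_minus_def by blast
    have "t * \<omega> p um + - s * - \<omega> p vm = 0"
      using p(2)[OF p(1) photon_memD(1)[OF ts(3)]] by (simp add: form_simps)
    then show False
      using combination_nonzero_mult_pos[of "\<omega> p um" "- \<omega> p vm" t "- s"] assms(2) ts by auto
  next
    case 3
    then obtain m n where mn: "up + m *\<^sub>R vm \<in> L" "um + n *\<^sub>R vp \<in> L" "m * n > 0"
      by (rule stemE)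
    have "\<omega> p up = - m * \<omega> p vm" "\<omega> p um = - n * \<omega> p vp"
      using p(2)[OF p(1) mn(1)] p(2)[OF p(1) mn(2)] by (simp_all add: form_simps)
    then have "(\<omega> p up * \<omega> p vp) * (\<omega> p um * \<omega> p vm) = (m * n) * (\<omega> p vm * \<omega> p vp)\<^sup>2"
      by (simp add: power2_eq_square)
    moreover have "\<dots> \<ge> 0"
      using mn(3) by simp
    ultimately show False
      using assms mult_pos_neg by (metis not_le)
  qed
qed

end

section \<open>Two crooked surfaces with disjoint boundary photons\<close>

text \<open>All four of \<open>a\<close>, \<open>b\<close>, \<open>a'\<close>, \<open>b'\<close>
  have the same sign, so combining with coefficients that are not of opposite signs produces no
  cancellation. This carries an inequality from the two edges of a wing to its interior.\<close>

lemma mult_pos_combination: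
  fixes a b a' b' s t :: real
  assumes "a * b > 0" "a' * b' > 0" "a * a' > 0" "s * t \<ge> 0" "(s, t) \<noteq> (0, 0)"
  shows "(s * a + t * a') * (s * b + t * b') > 0"
proof -
  have "a' * b > 0" "a * b' > 0"
    using assms(1-3) by (auto simp: zero_less_mult_iff)
  have "(s * a + t * a') * (s * b + t * b')
      = s\<^sup>2 * (a * b) + t\<^sup>2 * (a' * b') + (s * t) * (a * b' + a' * b)"
    by (simp add: power2_eq_square algebra_simps)
  moreover have "s\<^sup>2 * (a * b) + t\<^sup>2 * (a' * b') > 0"
    using assms by (cases "s = 0") (auto intro: add_pos_nonneg add_nonneg_pos)
  moreover have "(s * t) * (a * b' + a' * b) \<ge> 0"
    using assms(4) \<open>a' * b > 0\<close> \<open>a * b' > 0\<close> by simp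
  ultimately show ?thesis
    by linarith
qed

locale crooked_pair =
  C: crooked \<omega> up um vp vm + C': crooked \<omega> up' um' vp' vm'
  for \<omega> :: "'a::real_vector \<Rightarrow> 'a \<Rightarrow> real" and up um vp vm up' um' vp' vm' +
  assumes disj: "p \<in> {up, um, vp, vm} \<Longrightarrow> photon \<omega> p \<inter> crooked_surface \<omega> up' um' vp' vm' = {}"
    and disj': "p \<in> {up', um', vp', vm'} \<Longrightarrow> photon \<omega> p \<inter> crooked_surface \<omega> up um vp vm = {}"
begin

text \<open>The pairings form a 4 by 4 matrix with rows indexed by the first configuration and
  columns by the primed one; \<open>row\<close> compares entries within a row, \<open>col\<close>
  within a column.\<close>

lemma row:
  assumes "p \<in> {up, um, vp, vm}"
  shows "\<omega> p up' * \<omega> p vp' > 0" "\<omega> p um' * \<omega> p vm' < 0"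
  using C'.photon_disjointD[OF disj[OF assms]] .

lemma col:
  assumes "p \<in> {up', um', vp', vm'}"
  shows "\<omega> up p * \<omega> vp p > 0" "\<omega> um p * \<omega> vm p < 0"
  using C.photon_disjointD[OF disj'[OF assms]] C.skew[of p up] C.skew[of p um] C.skew[of p vp]
    C.skew[of p vm] by auto

lemma sgn_row:
  assumes "p \<in> {up, um, vp, vm}"
  shows "sgn (\<omega> p vp') = sgn (\<omega> p up')" "sgn (\<omega> p vm') = - sgn (\<omega> p um')"
  using sgn_eq_if_mult_pos[OF row(1)[OF assms]] sgn_eq_if_mult_neg[OF row(2)[OF assms]] by simp_all

lemma sgn_col:
  assumes "p \<in> {up', um', vp', vm'}"
  shows "sgn (\<omega> vp p) = sgn (\<omega> up p)" "sgn (\<omega> vm p) = - sgn (\<omega> um p)"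
  using sgn_eq_if_mult_pos[OF col(1)[OF assms]] sgn_eq_if_mult_neg[OF col(2)[OF assms]] by simp_all

text \<open>\<open>row\<close> gives the inequalities at both edges of the wing and
  \<open>col\<close> aligns the signs of the two edges, so every photon of the wing satisfies the
  criterion of \<open>photon_disjointI\<close>.\<close>

lemma wings_disjoint:
  assumes "L \<in> wing_plus \<omega> up vp \<union> wing_minus \<omega> um vm"
  shows "L \<notin> crooked_surface \<omega> up' um' vp' vm'"
proof -
  have "\<exists>p. L \<in> photon \<omega> p \<and> \<omega> p up' * \<omega> p vp' > 0 \<and> \<omega> p um' * \<omega> p vm' < 0"
    using assms
  proof
    assume "L \<in> wing_plus \<omega> up vp"
    then obtain t s where ts: "(t, s) \<noteq> (0, 0)" "t * s \<ge> 0" "L \<in> photon \<omega> (t *\<^sub>R up + s *\<^sub>R vp)"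
      unfolding wing_plus_def by blast
    have "(t * \<omega> up up' + s * \<omega> vp up') * (t * \<omega> up vp' + s * \<omega> vp vp') > 0"
      "(t * \<omega> up um' + s * \<omega> vp um') * (t * - \<omega> up vm' + s * - \<omega> vp vm') > 0"
      by (rule mult_pos_combination; use row[of up] row[of vp] col ts in simp)+
    with ts(3) show ?thesis
      by (intro exI[of _ "t *\<^sub>R up + s *\<^sub>R vp"]) (simp add: C.form_simps algebra_simps)
  next
    assume "L \<in> wing_minus \<omega> um vm"
    then obtain t s where ts: "(t, s) \<noteq> (0, 0)" "t * s \<le> 0" "L \<in> photon \<omega> (t *\<^sub>R um + s *\<^sub>R vm)"
      unfolding wing_minus_def by blast
    \<comment> \<open>As \<open>t * s\<close> is now nonpositive, the coefficients are
      \<open>t\<close> and \<open>- s\<close>; negating the pairings with \<open>vm\<close>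
      compensates and gives the alignment stated by \<open>col\<close>.\<close>
    have "(t * \<omega> um up' + - s * - \<omega> vm up') * (t * \<omega> um vp' + - s * - \<omega> vm vp') > 0"
      "(t * \<omega> um um' + - s * - \<omega> vm um') * (t * - \<omega> um vm' + - s * \<omega> vm vm') > 0"
      by (rule mult_pos_combination; use row[of um] row[of vm] col ts in simp)+
    with ts(3) show ?thesis
      by (intro exI[of _ "t *\<^sub>R um + s *\<^sub>R vm"]) (simp add: C.form_simps algebra_simps)
  qed
  then show ?thesis
    using C'.photon_disjointI by blast
qed

text \<open>Expanding \<open>\<omega> up' um' = 0\<close> in the first configuration gives four
  terms whose signs follow from \<open>sgn_col\<close>. If the product were -1, all four would have
  the same sign and could not sum to zero.\<close>

lemma sign_product:
  assumes "dim (UNIV :: 'a set) = 4"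
  shows "sgn (\<omega> up up') * sgn (\<omega> up um') * sgn (\<omega> um up') * sgn (\<omega> um um') = 1"
proof -
  let ?A = "sgn (\<omega> up up')" and ?B = "sgn (\<omega> up um')"
    and ?C = "sgn (\<omega> um up')" and ?D = "sgn (\<omega> um um')"
  have sum: "\<omega> up up' * \<omega> vm um' - \<omega> vm up' * \<omega> up um' + \<omega> um up' * \<omega> vp um'
      - \<omega> vp up' * \<omega> um um' = 0"
    using C.form_expansion[OF assms, of up' um'] by simp
  have "\<omega> up up' \<noteq> 0" "\<omega> up um' \<noteq> 0" "\<omega> um up' \<noteq> 0" "\<omega> um um' \<noteq> 0"
    using row[of up] row[of um] by auto
  then have pm: "?A = 1 \<or> ?A = -1" "?B = 1 \<or> ?B = -1" "?C = 1 \<or> ?C = -1" "?D = 1 \<or> ?D = -1"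
    by (auto simp: sgn_if)
  show ?thesis
  proof (rule ccontr)
    assume "\<not> ?thesis"
    then have "?A * ?D = - (?B * ?C)" and BC: "?B * ?C = 1 \<or> ?B * ?C = -1"
      using pm by auto
    then have "sgn (\<omega> up up' * \<omega> vm um') = ?B * ?C" "sgn (\<omega> vm up' * \<omega> up um') = - (?B * ?C)"
      "sgn (\<omega> um up' * \<omega> vp um') = ?B * ?C" "sgn (\<omega> vp up' * \<omega> um um') = - (?B * ?C)"
      by (simp_all add: sgn_mult sgn_col mult.commute)
    with BC sum show False
      by (auto simp: sgn_1_pos sgn_1_neg)
  qed
qed

lemma stems_disjoint:
  assumes "dim (UNIV :: 'a set) = 4"
  shows "stem \<omega> up um vp vm \<inter> stem \<omega> up' um' vp' vm' = {}"
proof (rule ccontr)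
  assume "\<not> ?thesis"
  then obtain L where L: "L \<in> stem \<omega> up um vp vm" "L \<in> stem \<omega> up' um' vp' vm'"
    by blast
  from L(1) obtain m n where mn: "up + m *\<^sub>R vm \<in> L" "um + n *\<^sub>R vp \<in> L" "m * n > 0"
    by (rule C.stemE)
  from L(2) obtain m' n' where mn': "up' + m' *\<^sub>R vm' \<in> L" "um' + n' *\<^sub>R vp' \<in> L" "m' * n' > 0"
    by (rule C'.stemE)
  have iso: "\<omega> x y = 0" if "x \<in> L" "y \<in> L" for x y
    using C.crooked_surface_isotropic[OF _ that] L(1) by (auto simp: crooked_surface_def)
  define A B C D where "A = sgn (\<omega> up up')" and "B = sgn (\<omega> up um')"
    and "C = sgn (\<omega> um up')" and "D = sgn (\<omega> um um')"
  define \<mu> \<mu>' where "\<mu> = sgn m" and "\<mu>' = sgn m'"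
  have sgns: "sgn (\<omega> up up') = A" "sgn (\<omega> vp up') = A" "sgn (\<omega> up vp') = A" "sgn (\<omega> vp vp') = A"
    "sgn (\<omega> up um') = B" "sgn (\<omega> vp um') = B" "sgn (\<omega> up vm') = - B" "sgn (\<omega> vp vm') = - B"
    "sgn (\<omega> um up') = C" "sgn (\<omega> vm up') = - C" "sgn (\<omega> um vp') = C" "sgn (\<omega> vm vp') = - C"
    "sgn (\<omega> um um') = D" "sgn (\<omega> vm um') = - D" "sgn (\<omega> um vm') = - D" "sgn (\<omega> vm vm') = D"
    unfolding A_def B_def C_def D_def
    by (simp_all add: sgn_row sgn_col)
  \<comment> \<open>Positivity of \<open>m * n\<close> and \<open>m' * n'\<close> leaves only one
    unknown sign per stem.\<close>
  have \<mu>: "sgn m = \<mu>" "sgn n = \<mu>" "sgn m' = \<mu>'" "sgn n' = \<mu>'"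
    unfolding \<mu>_def \<mu>'_def using mn(3) mn'(3) by (auto simp: sgn_eq_if_mult_pos)
  have \<mu>_cases: "\<mu> = 1 \<or> \<mu> = -1" "\<mu>' = 1 \<or> \<mu>' = -1"
    unfolding \<mu>_def \<mu>'_def using mn(3) mn'(3) by (auto simp: sgn_if)
  have prod: "A * B * C * D = 1"
    unfolding A_def B_def C_def D_def by (rule sign_product[OF assms])
  have "\<omega> up up' + m * \<omega> vm up' + m' * \<omega> up vm' + m * m' * \<omega> vm vm' = 0"
    using iso[OF mn(1) mn'(1)] by (simp add: C.form_simps algebra_simps)
  \<comment> \<open>In the product of the four signs, \<mu> and \<mu>' occur squared and the minus
    signs are even in number, so the product is \<open>A * B * C * D\<close>; the same holds for the
    next three equations.\<close>
  from signs_cancel[OF this] have 1: "A - \<mu> * C - \<mu>' * B + \<mu> * \<mu>' * D = 0"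
    using \<mu>_cases prod by (elim disjE) (simp_all add: sgn_mult sgns \<mu> mult_ac)
  have "\<omega> up um' + n' * \<omega> up vp' + m * \<omega> vm um' + m * n' * \<omega> vm vp' = 0"
    using iso[OF mn(1) mn'(2)] by (simp add: C.form_simps algebra_simps)
  from signs_cancel[OF this] have 2: "B + \<mu>' * A - \<mu> * D - \<mu> * \<mu>' * C = 0"
    using \<mu>_cases prod by (elim disjE) (simp_all add: sgn_mult sgns \<mu> mult_ac)
  have "\<omega> um up' + m' * \<omega> um vm' + n * \<omega> vp up' + n * m' * \<omega> vp vm' = 0"
    using iso[OF mn(2) mn'(1)] by (simp add: C.form_simps algebra_simps)
  from signs_cancel[OF this] have 3: "C - \<mu>' * D + \<mu> * A - \<mu> * \<mu>' * B = 0"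
    using \<mu>_cases prod by (elim disjE) (simp_all add: sgn_mult sgns \<mu> mult_ac)
  have "\<omega> um um' + n' * \<omega> um vp' + n * \<omega> vp um' + n * n' * \<omega> vp vp' = 0"
    using iso[OF mn(2) mn'(2)] by (simp add: C.form_simps algebra_simps)
  from signs_cancel[OF this] have 4: "D + \<mu>' * C + \<mu> * B + \<mu> * \<mu>' * A = 0"
    using \<mu>_cases prod by (elim disjE) (simp_all add: sgn_mult sgns \<mu> mult_ac)
  \<comment> \<open>Since \<mu> and \<mu>' square to 1, the sum of equation 1, \<mu>' times equation
    2, \<mu> times equation 3 and \<open>\<mu> * \<mu>'\<close> times equation 4 is
    \<open>4 * A = 0\<close>.\<close>
  have "A = 0"
    using \<mu>_cases 1 2 3 4 by (elim disjE) simp_all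
  with prod show False
    by simp
qed

end

theorem theorem3:
  fixes \<omega> :: "'a::real_vector \<Rightarrow> 'a \<Rightarrow> real"
    and up um vp vm up' um' vp' vm' :: 'a
  assumes "dim (UNIV :: 'a set) = 4"
    and "symplectic_form \<omega>"
    and "crooked_config \<omega> up um vp vm"
    and "crooked_config \<omega> up' um' vp' vm'"
  defines "C \<equiv> crooked_surface \<omega> up um vp vm"
    and "C' \<equiv> crooked_surface \<omega> up' um' vp' vm'"
  shows "C \<inter> C' = {} \<longleftrightarrow>
    (\<forall>p \<in> {up, um, vp, vm}. photon \<omega> p \<inter> C' = {}) \<and>
    (\<forall>p \<in> {up', um', vp', vm'}. photon \<omega> p \<inter> C = {})"
proof -
  interpret C: crooked \<omega> up um vp vm
    using assms by unfold_locales (auto simp: symplectic_form_def)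
  interpret C': crooked \<omega> up' um' vp' vm'
    using assms by unfold_locales auto
  show ?thesis
  proof
    assume "C \<inter> C' = {}"
    then show "(\<forall>p \<in> {up, um, vp, vm}. photon \<omega> p \<inter> C' = {}) \<and>
        (\<forall>p \<in> {up', um', vp', vm'}. photon \<omega> p \<inter> C = {})"
      using C.boundary_photon_subset C'.boundary_photon_subset unfolding C_def C'_def by blast
  next
    assume disj: "(\<forall>p \<in> {up, um, vp, vm}. photon \<omega> p \<inter> C' = {}) \<and>
        (\<forall>p \<in> {up', um', vp', vm'}. photon \<omega> p \<inter> C = {})"
    interpret CC': crooked_pair \<omega> up um vp vm up' um' vp' vm'
      using disj unfolding C_def C'_def by unfold_locales blast+
    \<comment> \<open>Exchanging the two surfaces separates the wings of \<open>C'\<close> from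
      \<open>C\<close> as well, which leaves the two stems.\<close>
    interpret C'C: crooked_pair \<omega> up' um' vp' vm' up um vp vm
      using disj unfolding C_def C'_def by unfold_locales blast+
    show "C \<inter> C' = {}"
      using CC'.wings_disjoint C'C.wings_disjoint CC'.stems_disjoint[OF assms(1)]
      unfolding C_def C'_def by (auto simp: crooked_surface_def)
  qed
qed

end
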